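(* Let $X$ be a non-negative integer-valued random variable with probability function $p$, finite mean $\mu$, and let $q(x)=\delta x^2+\beta x+\gamma$ (real coefficients) be such that $\sum_{j=0}^x(\mu-j)p(j)=q(x)p(x)$ for all $x=0,1,2,\ldots$. Let $J=\{x\in\mathbb{Z}:p(x)>0\}$. Fix $n\in\{1,2,\ldots\}$ and assume $\mathbb{E}[X^{2n}]<\infty$. Then for any function $g:J\to\mathbb{R}$ satisfying $$\mathbb{E}\bigl[q^{[k]}(X)|\Delta^k[g(X)]|\bigr]<\infty\qquad\text{for } k=0,1,\ldots,n,$$ the bound $$\operatorname{Var} g(X)\ \ge\ \sum_{k=1}^n\frac{\mathbb{E}^2\bigl[q^{[k]}(X)\Delta^k[g(X)]\bigr]}{k!\,\mathbb{E}[q^{[k]}(X)]\prod_{j=k-1}^{2k-2}(1-j\delta)}$$ holds, where the $k$-th term in the sum is treated as zero whenever $\mathbb{E}[q^{[k]}(X)]=0$. Equality holds if and only if $g$ is (on $J$) a polynomial of degree at most $n$.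
   Context: $\Delta$ is the forward difference operator: $\Delta[g(x)]=g(x+1)-g(x)$, $\Delta^k=\Delta\circ\Delta^{k-1}$, $\Delta^0=\mathrm{id}$. $q^{[k]}(x)=q(x)q(x+1)\cdots q(x+k-1)$, $q^{[0]}\equiv1$. $\mathbb{E}^2[Y]$ denotes $(\mathbb{E}[Y])^2$. The polynomial $q$ has degree at most 2 ($\delta,\beta$ may be zero). $J$ is automatically a finite or infinite integer interval. If $x\in J$ but $x+k\notin J$ then $q^{[k]}(x)=0$, and $q^{[k]}(x)\Delta^k[g(x)]$ is read as $0$. $\operatorname{Var} g(X)\in[0,\infty]$ is $+\infty$ when $\mathbb{E}[g^2(X)]=\infty$. *)

theory Defs
  imports "HOL-Probability.Probability" "HOL-Computational_Algebra.Polynomial"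
begin

definition fwd_diff :: "(nat \<Rightarrow> real) \<Rightarrow> nat \<Rightarrow> real" where
  "fwd_diff g x = g (x + 1) - g x"

text \<open>The product \<open>q(x) q(x+1) \<dots> q(x+k-1)\<close>, with \<open>k\<close> factors.\<close>

definition rising_prod :: "(nat \<Rightarrow> real) \<Rightarrow> nat \<Rightarrow> nat \<Rightarrow> real" where
  "rising_prod q k x = (\<Prod>i<k. q (x + i))"

text \<open>Variance with values in \<open>[0, \<infinity>]\<close>. The case distinction is needed because the Bochner
  integral of a non-integrable function is \<open>0\<close>.\<close>

definition ext_variance :: "'a measure \<Rightarrow> ('a \<Rightarrow> real) \<Rightarrow> ereal" where
  "ext_variance M Y =
     (if integrable M (\<lambda>\<omega>. (Y \<omega>)\<^sup>2) then ereal (prob_space.variance M Y) else \<infinity>)"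

end

(*
  Idea. Let w_k(x) = q^[k](x) p(x) and r(x) = q(x) + x - mu. The hypothesis on p says
  r(x) p(x) = q(x-1) p(x-1), so summation by parts gives
    sum w_{k+1} h Delta f = sum w_k (T_k h) f,   T_k h(x) = r(x) h(x-1) - q(x+k) h(x),
  where T_k raises the degree of a polynomial by one. Hence P_k = T_0 ... T_{k-1} 1 satisfies
  E[P_k(X) g(X)] = E[q^[k](X) Delta^k g(X)], and its leading coefficient is the product of the
  1 - j delta, k-1 <= j <= 2k-2. Taking g = P_l shows that the P_k are orthogonal with
  E[P_k(X)^2] = k! E[q^[k](X)] prod (1 - j delta), so the bound is Bessel's inequality.
  A Hardy-type inequality, applied k times, yields the absolute convergence needed for the
  summations by parts from E[q^[k](X) |Delta^k g(X)|] < infinity alone.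
*)
theory Submission
  imports Defs
begin

section \<open>Expectations of functions of \<open>X\<close> as series weighted by
  \<open>p\<close>\<close>

lemma distr_eq_density:
  fixes X :: "'a \<Rightarrow> nat"
  assumes "prob_space M" "X \<in> measurable M (count_space UNIV)" "\<And>x. p x = \<P>(\<omega> in M. X \<omega> = x)"
  shows "distr M (count_space UNIV) X = density (count_space UNIV) (\<lambda>x. ennreal (p x))"
proof (rule measure_eqI_countable[where A = UNIV])
  interpret prob_space M by fact
  show "emeasure (distr M (count_space UNIV) X) {a} =
      emeasure (density (count_space UNIV) (\<lambda>x. ennreal (p x))) {a}" for a
  proof -
    have "emeasure (distr M (count_space UNIV) X) {a} = emeasure M (X -` {a} \<inter> space M)"
      using assms(2) by (simp add: emeasure_distr)
    also have "X -` {a} \<inter> space M = {\<omega> \<in> space M. X \<omega> = a}" by auto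
    also have "emeasure M \<dots> = ennreal (p a)" by (simp add: assms(3) emeasure_eq_measure)
    also have "\<dots> = emeasure (density (count_space UNIV) (\<lambda>x. ennreal (p x))) {a}"
      by (simp add: emeasure_density nn_integral_count_space_indicator)
    finally show ?thesis .
  qed
qed (use assms in auto)

lemma
  fixes X :: "'a \<Rightarrow> nat" and f :: "nat \<Rightarrow> real"
  assumes "prob_space M" "X \<in> measurable M (count_space UNIV)" "\<And>x. p x = \<P>(\<omega> in M. X \<omega> = x)"
  shows integrable_iff_summable: "integrable M (\<lambda>\<omega>. f (X \<omega>)) \<longleftrightarrow> summable (\<lambda>x. p x * \<bar>f x\<bar>)"
    and expectation_sums:
      "integrable M (\<lambda>\<omega>. f (X \<omega>)) \<Longrightarrow> (\<lambda>x. p x * f x) sums (\<integral>\<omega>. f (X \<omega>) \<partial>M)"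
proof -
  let ?D = "density (count_space UNIV) (\<lambda>x. ennreal (p x))"
  have pn: "0 \<le> p x" for x by (simp add: assms(3))
  have D: "integrable M (\<lambda>\<omega>. f (X \<omega>)) \<longleftrightarrow> integrable ?D f" "(\<integral>\<omega>. f (X \<omega>) \<partial>M) = integral\<^sup>L ?D f"
    using integrable_distr_eq[OF assms(2), of f] integral_distr[OF assms(2), of f]
    by (simp_all add: distr_eq_density[OF assms])
  have I: "integrable ?D f \<longleftrightarrow> integrable (count_space UNIV) (\<lambda>x. p x * f x)"
    using pn by (subst integrable_density) auto
  show "integrable M (\<lambda>\<omega>. f (X \<omega>)) \<longleftrightarrow> summable (\<lambda>x. p x * \<bar>f x\<bar>)"
    unfolding D I by (simp add: integrable_count_space_nat_iff abs_mult pn)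
  assume "integrable M (\<lambda>\<omega>. f (X \<omega>))"
  then have "integrable (count_space UNIV) (\<lambda>x. p x * f x)" by (simp add: D I)
  moreover have "integral\<^sup>L ?D f = (\<integral>x. p x * f x \<partial>count_space UNIV)"
    using pn by (subst integral_density) auto
  ultimately show "(\<lambda>x. p x * f x) sums (\<integral>\<omega>. f (X \<omega>) \<partial>M)"
    unfolding D using sums_integral_count_space_nat by metis
qed

section \<open>Top coefficients and growth of real polynomials\<close>

text \<open>By the binomial theorem a shift by \<open>a\<close> keeps the top coefficient and adds
  \<open>a * m\<close> times it to the next one. The bound \<open>m\<close> allows
  \<open>coeff h m = 0\<close>; at \<open>m = 0\<close> the index \<open>m - 1\<close> truncates to
  0 and both sides are 0.\<close>

lemma coeff_pcompose_shift_diff: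
  fixes h :: "real poly"
  assumes "degree h \<le> m"
  shows "(\<forall>i\<ge>m. coeff (pcompose h [:a, 1:] - h) i = 0) \<and>
    coeff (pcompose h [:a, 1:] - h) (m - 1) = a * real m * coeff h m"
  using assms
proof (induction h arbitrary: m)
  case 0
  then show ?case by simp
next
  case (pCons c h)
  let ?D = "pcompose h [:a, 1:] - h"
  have eq: "pcompose (pCons c h) [:a, 1:] - pCons c h = pCons 0 ?D + smult a h + smult a ?D"
    by (simp add: pcompose_pCons algebra_simps smult_diff_right)
  show ?case
  proof (cases m)
    case 0
    then show ?thesis using pCons.prems pCons.hyps by (auto simp: eq split: if_splits)
  next
    case (Suc l)
    have "degree h \<le> l" using pCons.prems Suc by (auto split: if_splits)
    from pCons.IH[OF this] this show ?thesis
      unfolding eq by (auto simp: Suc coeff_pCons coeff_eq_0 algebra_simps split: nat.splits)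
  qed
qed

text \<open>Uses degree bounds instead of exact degrees because \<open>\<delta>\<close>, and with it
  a top coefficient, may be 0.\<close>

lemma coeff_mult_degree_le:
  fixes f h :: "real poly"
  assumes "degree f \<le> a" "degree h \<le> b"
  shows "coeff (f * h) (a + b) = coeff f a * coeff h b"
proof (cases "degree f = a \<and> degree h = b")
  case True
  then show ?thesis using coeff_mult_degree_sum by blast
next
  case False
  then have "degree f + degree h < a + b" using assms by linarith
  moreover have "degree (f * h) \<le> degree f + degree h" by (rule degree_mult_le)
  ultimately have "coeff (f * h) (a + b) = 0" by (intro coeff_eq_0) linarith
  moreover have "coeff f a * coeff h b = 0"
    using False assms by (auto simp: le_less coeff_eq_0)
  ultimately show ?thesis by simp
qed

text \<open>Powers of x + 1 are monotone in the exponent also at x = 0, so one power bounds every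
  monomial.\<close>

lemma poly_abs_le_power:
  fixes h :: "real poly"
  assumes "degree h \<le> d"
  obtains C where "C \<ge> 0" "\<And>x::nat. \<bar>poly h (real x)\<bar> \<le> C * (real x + 1) ^ d"
proof
  show "0 \<le> (\<Sum>i\<le>d. \<bar>coeff h i\<bar>)" by (simp add: sum_nonneg)
  fix x :: nat
  have "\<bar>poly h (real x)\<bar> = \<bar>\<Sum>i\<le>d. coeff h i * real x ^ i\<bar>"
    by (subst poly_as_sum_of_monoms'[OF assms, symmetric]) (simp add: poly_sum poly_monom)
  also have "\<dots> \<le> (\<Sum>i\<le>d. \<bar>coeff h i * real x ^ i\<bar>)" by (rule sum_abs)
  also have "\<dots> \<le> (\<Sum>i\<le>d. \<bar>coeff h i\<bar> * (real x + 1) ^ d)"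
  proof (rule sum_mono)
    fix i assume "i \<in> {..d}"
    have "real x ^ i \<le> (real x + 1) ^ i" by (intro power_mono) auto
    also have "\<dots> \<le> (real x + 1) ^ d" using \<open>i \<in> {..d}\<close> by (intro power_increasing) auto
    finally show "\<bar>coeff h i * real x ^ i\<bar> \<le> \<bar>coeff h i\<bar> * (real x + 1) ^ d"
      by (simp add: abs_mult mult_left_mono)
  qed
  finally show "\<bar>poly h (real x)\<bar> \<le> (\<Sum>i\<le>d. \<bar>coeff h i\<bar>) * (real x + 1) ^ d"
    by (simp add: sum_distrib_right)
qed

lemma poly_eventually_ge_power:
  fixes h :: "real poly"
  assumes "degree h \<le> d" "coeff h d > 0"
  obtains c x0 where "c > 0" "\<And>x::nat. x \<ge> x0 \<Longrightarrow> c * (real x + 1) ^ d \<le> poly h (real x)"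
proof -
  \<comment> \<open>Half the top coefficient: removing c (x + 1)^d leaves a polynomial of degree d
    whose leading coefficient is again c > 0.\<close>
  define c where "c = coeff h d / 2"
  have c: "c > 0" using assms by (simp add: c_def)
  define f where "f = h - smult c ([:1, 1:] ^ d)"
  have cf: "coeff f d = c" using coeff_linear_power[of "1::real" d] by (simp add: f_def c_def)
  have "degree f \<le> d" unfolding f_def
    using assms(1) by (intro degree_diff_le) (auto simp: degree_linear_power)
  with cf c have "degree f = d" by (intro antisym le_degree) auto
  then have "lead_coeff f > 0" using cf c by simp
  then obtain N where N: "\<And>x. x \<ge> N \<Longrightarrow> lead_coeff f \<le> poly f x"
    using poly_pinfty_gt_lc by metis
  show ?thesis
  proof (rule that[OF c])
    fix x :: nat assume "x \<ge> nat \<lceil>N\<rceil>"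
    then have "lead_coeff f \<le> poly f (real x)" by (intro N) linarith
    then have "0 \<le> poly f (real x)" using \<open>lead_coeff f > 0\<close> by linarith
    then show "c * (real x + 1) ^ d \<le> poly h (real x)" by (simp add: f_def add.commute)
  qed
qed

lemma not_summable_ge_harmonic:
  assumes "c > 0" "\<And>x::nat. x \<ge> N \<Longrightarrow> c / (real x + 1) \<le> a x"
  shows "\<not> summable a"
proof
  assume "summable a"
  then have "summable (\<lambda>x. c / (real x + 1))"
  proof (rule summable_comparison_test'[where N = N])
    show "norm (c / (real n + 1)) \<le> a n" if "n \<ge> N" for n using assms that by simp
  qed
  then have "summable (\<lambda>x. inverse c * (c / (real x + 1)))" by (rule summable_mult)
  moreover have "inverse c * (c / (real x + 1)) = inverse (real (Suc x))" for x
    using assms(1) by (simp add: field_simps)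
  ultimately have "summable (\<lambda>x. inverse (real (Suc x)))" by simp
  then show False
    using not_summable_harmonic[where 'a = real] by (subst (asm) summable_Suc_iff) blast
qed

section \<open>Weights, the operator \<open>T\<close> and the Rodrigues polynomials\<close>

locale cumulative_ord =
  fixes p q :: "nat \<Rightarrow> real" and \<mu> \<delta> \<beta> \<gamma> :: real
  assumes p_nonneg: "p x \<ge> 0"
    and p_sums: "p sums 1"
    and mean_sums: "(\<lambda>x. p x * real x) sums \<mu>"
    and q_eq: "q x = \<delta> * (real x)\<^sup>2 + \<beta> * real x + \<gamma>"
    and cumulative: "(\<Sum>j=0..x. (\<mu> - real j) * p j) = q x * p x"
begin

definition w :: "nat \<Rightarrow> nat \<Rightarrow> real" where
  "w k x = rising_prod q k x * p x"

definition qpoly :: "real poly" where "qpoly = [:\<gamma>, \<beta>, \<delta>:]"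

definition rpoly :: "real poly" where "rpoly = [:\<gamma> - \<mu>, \<beta> + 1, \<delta>:]"

definition T :: "nat \<Rightarrow> real poly \<Rightarrow> real poly" where
  "T j h = rpoly * pcompose h [:-1, 1:] - pcompose qpoly [:real j, 1:] * h"

lemma w_0: "w 0 x = p x"
  by (simp add: w_def rising_prod_def)

lemma w_Suc: "w (Suc k) x = q (x + k) * w k x"
  by (simp add: w_def rising_prod_def)

text \<open>Splitting off the first factor, not the last, exposes \<open>q x * p x\<close>, which
  \<open>rpoly_p_Suc\<close> moves to the point \<open>Suc x\<close>.\<close>

lemma w_Suc': "w (Suc k) x = q x * p x * rising_prod q k (Suc x)"
  by (simp add: w_def rising_prod_def prod.lessThan_Suc_shift del: prod.lessThan_Suc)

lemma poly_qpoly: "poly qpoly (real x) = q x"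
  by (simp add: qpoly_def q_eq algebra_simps power2_eq_square)

text \<open>The case x = 0 of r(x) p(x) = q(x-1) p(x-1), with p(-1) read as 0.\<close>

lemma rpoly_p_0: "poly rpoly 0 * p 0 = 0"
  using cumulative[of 0] by (auto simp: q_eq rpoly_def algebra_simps)

lemma rpoly_p_Suc: "poly rpoly (real (Suc x)) * p (Suc x) = q x * p x"
proof -
  have "q (Suc x) * p (Suc x) = q x * p x + (\<mu> - real (Suc x)) * p (Suc x)"
    using cumulative[of "Suc x"] cumulative[of x] by simp
  then show ?thesis
    by (simp add: q_eq rpoly_def algebra_simps power2_eq_square)
qed

text \<open>The operator \<open>T j\<close> is the adjoint of \<open>\<Delta>\<close> between the weights \<open>w (Suc j)\<close> and \<open>w j\<close>.\<close>

lemma w_T: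
  "w j x * poly (T j h) (real x) =
    (case x of 0 \<Rightarrow> 0 | Suc y \<Rightarrow> w (Suc j) y * poly h (real y)) - w (Suc j) x * poly h (real x)"
proof -
  have q: "poly qpoly (real j + real x) = q (x + j)"
    using poly_qpoly[of "x + j"] by (simp add: add.commute)
  have r: "poly rpoly (real x) * p x * poly h (real x - 1) * rising_prod q j x =
      (case x of 0 \<Rightarrow> 0 | Suc y \<Rightarrow> w (Suc j) y * poly h (real y))"
  proof (cases x)
    case (Suc y)
    show ?thesis using rpoly_p_Suc[of y] by (simp add: Suc w_Suc' algebra_simps)
  qed (simp add: rpoly_p_0)
  have "w j x * poly (T j h) (real x) =
      poly rpoly (real x) * p x * poly h (real x - 1) * rising_prod q j x -
      q (x + j) * w j x * poly h (real x)"
    by (simp add: T_def poly_pcompose q algebra_simps) (simp add: w_def)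
  then show ?thesis by (simp add: r w_Suc)
qed

text \<open>Both products in \<open>T j h\<close> have the same coefficient at x^(m+2), and it
  cancels. At x^(m+1), the linear polynomial \<open>l\<close> contributes 1 - 2j\<delta> and the
  backward shift of \<open>h\<close> contributes -m\<delta>.\<close>

lemma T_degree_coeff:
  assumes "degree h \<le> m"
  shows "degree (T j h) \<le> Suc m" "coeff (T j h) (Suc m) = (1 - real (m + 2 * j) * \<delta>) * coeff h m"
proof -
  define D where "D = pcompose h [:-1, 1:] - h"
  have D: "\<And>i. i \<ge> m \<Longrightarrow> coeff D i = 0" "coeff D (m - 1) = - real m * coeff h m"
    using coeff_pcompose_shift_diff[OF assms, of "-1"] by (auto simp: D_def)
  \<comment> \<open>This is r(x) - q(x + j); the quadratic terms cancel.\<close>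
  define l where "l = [:- \<mu> - \<delta> * (real j)\<^sup>2 - \<beta> * real j, 1 - 2 * real j * \<delta>:]"
  have T: "T j h = l * h + rpoly * D"
  proof -
    have "rpoly = pcompose qpoly [:real j, 1:] + l"
      by (simp add: rpoly_def qpoly_def l_def pcompose_pCons algebra_simps power2_eq_square)
    moreover have "pcompose h [:-1, 1:] = h + D" by (simp add: D_def)
    ultimately show ?thesis unfolding T_def by (simp add: algebra_simps)
  qed
  have l: "degree l \<le> 1" "coeff l 1 = 1 - 2 * real j * \<delta>" by (auto simp: l_def)
  have r: "degree rpoly \<le> 2" "coeff rpoly 2 = \<delta>" by (auto simp: rpoly_def numeral_2_eq_2)
  have rD: "degree (rpoly * D) \<le> Suc m \<and> coeff (rpoly * D) (Suc m) = - real m * \<delta> * coeff h m"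
  proof (cases m)
    case 0
    then have "D = 0" using D(1) by (intro poly_eqI) auto
    then show ?thesis using 0 by simp
  next
    case (Suc i)
    have "degree D \<le> i"
    proof (rule degree_le, intro allI impI)
      fix k assume "i < k" then show "coeff D k = 0" using D(1) Suc by simp
    qed
    with r coeff_mult_degree_le[OF r(1) this] degree_mult_le[of rpoly D] show ?thesis
      using D(2) Suc by (simp add: numeral_2_eq_2)
  qed
  have lh: "degree (l * h) \<le> Suc m" "coeff (l * h) (Suc m) = (1 - 2 * real j * \<delta>) * coeff h m"
    using coeff_mult_degree_le[OF l(1) assms] degree_mult_le[of l h] l assms by simp_all
  show "degree (T j h) \<le> Suc m" unfolding T using lh rD by (intro degree_add_le) auto
  show "coeff (T j h) (Suc m) = (1 - real (m + 2 * j) * \<delta>) * coeff h m"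
    unfolding T using lh rD by (simp add: algebra_simps)
qed

text \<open>\<open>rodrigues j i\<close> is T_j ... T_(j+i-1) applied to 1, so
  \<open>rodrigues 0 k\<close> is P_k. By \<open>w_T\<close>, its product with \<open>w j\<close> is
  (-1)^i times the i-th backward difference of \<open>w (j + i)\<close>: a discrete Rodrigues
  formula.\<close>

primrec rodrigues :: "nat \<Rightarrow> nat \<Rightarrow> real poly" where
  "rodrigues j 0 = 1"
| "rodrigues j (Suc i) = T j (rodrigues (Suc j) i)"

lemma rodrigues_degree: "degree (rodrigues j i) \<le> i"
  by (induction i arbitrary: j) (auto intro: T_degree_coeff)

text \<open>The operator at level j + l acts on degree at most i - 1 - l, so its factor is 1 - (i -
  1 - l + 2(j + l))\<delta>.\<close>

lemma rodrigues_coeff: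
  "coeff (rodrigues j i) i = (\<Prod>l<i. 1 - (real i - 1 + 2 * real j + real l) * \<delta>)"
proof (induction i arbitrary: j)
  case (Suc i)
  have "coeff (rodrigues j (Suc i)) (Suc i) =
      (1 - real (i + 2 * j) * \<delta>) * (\<Prod>l<i. 1 - (real i - 1 + 2 * real (Suc j) + real l) * \<delta>)"
    unfolding rodrigues.simps T_degree_coeff(2)[OF rodrigues_degree] Suc ..
  also have "\<dots> = (\<Prod>l<Suc i. 1 - (real (Suc i) - 1 + 2 * real j + real l) * \<delta>)"
    by (subst prod.lessThan_Suc_shift) (simp add: algebra_simps)
  finally show ?case .
qed simp

lemma rodrigues_0_coeff:
  assumes "k \<ge> 1"
  shows "coeff (rodrigues 0 k) k = (\<Prod>j=k-1..2*k-2. 1 - real j * \<delta>)"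
proof -
  have "coeff (rodrigues 0 k) k = (\<Prod>l=0..<k. 1 - real (l + (k - 1)) * \<delta>)"
    using assms unfolding rodrigues_coeff
    by (intro prod.cong) (auto simp: of_nat_diff algebra_simps)
  also have "\<dots> = (\<Prod>j=0 + (k - 1)..<k + (k - 1). 1 - real j * \<delta>)"
    by (rule prod.shift_bounds_nat_ivl[symmetric])
  also have "{0 + (k - 1)..<k + (k - 1)} = {k-1..2*k-2}" using assms by auto
  finally show ?thesis .
qed

section \<open>Support of \<open>p\<close> and positivity of the weights\<close>

text \<open>The centred series of (i - \<mu>) p(i) sums to 0, so the head that defines q(x) p(x) can
  be exchanged for the tail beyond x.\<close>

lemma qp_tail: "(\<lambda>i. (real (i + Suc x) - \<mu>) * p (i + Suc x)) sums (q x * p x)"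
proof -
  have "(\<lambda>i. p i * real i - \<mu> * p i) sums (\<mu> - \<mu> * 1)"
    by (intro sums_diff mean_sums sums_mult p_sums)
  then have "(\<lambda>i. (real i - \<mu>) * p i) sums 0" by (simp add: algebra_simps)
  then have "(\<lambda>i. (real (i + Suc x) - \<mu>) * p (i + Suc x)) sums
      (0 - (\<Sum>i<Suc x. (real i - \<mu>) * p i))"
    by (rule sums_split_initial_segment)
  also have "0 - (\<Sum>i<Suc x. (real i - \<mu>) * p i) = (\<Sum>j=0..x. (\<mu> - real j) * p j)"
    by (simp add: sum_negf[symmetric] atLeast0AtMost lessThan_Suc_atMost algebra_simps
        del: sum.lessThan_Suc)
  finally show ?thesis by (simp only: cumulative)
qed

text \<open>For x < \<mu> all terms of the head are nonnegative, otherwise all terms of the tail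
  are. The point \<open>y\<close> or \<open>z\<close> supplies a strictly positive term.\<close>

lemma qp_pos:
  assumes "y \<le> x" "x < z" "p y > 0" "p z > 0"
  shows "q x * p x > 0"
proof (cases "real x < \<mu>")
  case True
  have "0 < (\<mu> - real y) * p y" using True assms by simp
  also have "\<dots> \<le> (\<Sum>j=0..x. (\<mu> - real j) * p j)"
    using assms True p_nonneg by (intro member_le_sum) auto
  finally show ?thesis by (simp add: cumulative)
next
  case False
  have nn: "0 \<le> (real (i + Suc x) - \<mu>) * p (i + Suc x)" for i
    using False p_nonneg by (intro mult_nonneg_nonneg) auto
  have "0 < (real z - \<mu>) * p z" using False assms by simp
  also have "z = (z - Suc x) + Suc x" using assms by simp
  also have "(real ((z - Suc x) + Suc x) - \<mu>) * p ((z - Suc x) + Suc x) \<le>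
      (\<Sum>i. (real (i + Suc x) - \<mu>) * p (i + Suc x))"
    using sum_le_suminf[OF sums_summable[OF qp_tail], of "{z - Suc x}" x] nn by simp
  finally show ?thesis using qp_tail[of x] sums_unique by metis
qed

lemma support_interval:
  assumes "y \<le> x" "x \<le> z" "p y > 0" "p z > 0"
  shows "p x > 0"
  using qp_pos[of y x z] assms p_nonneg[of x] by (cases "x = z") (auto simp: less_le)

lemma q_pos:
  assumes "p x > 0" "p z > 0" "x < z"
  shows "q x > 0"
  using qp_pos[of x x z] assms by (simp add: zero_less_mult_iff)

text \<open>Here \<open>x\<close> is the last point of the support, so the tail in
  \<open>qp_tail\<close> is zero.\<close>

lemma q_eq_0:
  assumes "p x > 0" "p (Suc x) = 0"
  shows "q x = 0"
proof -
  have "p z = 0" if "z > x" for z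
    using support_interval[of x "Suc x" z] that assms p_nonneg[of z] by (force simp: less_le)
  then have "(\<lambda>i. (real (i + Suc x) - \<mu>) * p (i + Suc x)) = (\<lambda>i. 0)" by auto
  then have "q x * p x = 0" using qp_tail[of x] sums_unique2 sums_zero by metis
  then show ?thesis using assms by simp
qed

text \<open>Along the support \<open>q\<close> is positive until the right end, where it vanishes
  and cuts off the product. This realises the convention that the k-th difference term is read as 0
  when x + k lies outside the support.\<close>

lemma w_pos_iff: "w k x \<ge> 0 \<and> (w k x > 0 \<longleftrightarrow> p x > 0 \<and> p (x + k) > 0)"
proof (induction k)
  case 0
  then show ?case by (simp add: w_0 p_nonneg)
next
  case (Suc k)
  show ?case
  proof (cases "w k x > 0")
    case True
    then have px: "p x > 0" "p (x + k) > 0" using Suc by auto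
    show ?thesis
    proof (cases "p (Suc (x + k)) > 0")
      case True
      with px q_pos[of "x + k" "Suc (x + k)"] \<open>w k x > 0\<close> show ?thesis by (simp add: w_Suc)
    next
      case False
      then have "q (x + k) = 0" using q_eq_0 px p_nonneg[of "Suc (x + k)"] by (simp add: less_le)
      with False show ?thesis by (simp add: w_Suc)
    qed
  next
    case False
    then have "w k x = 0" "\<not> (p x > 0 \<and> p (x + k) > 0)" using Suc by auto
    then show ?thesis
      using support_interval[of x "x + k" "x + Suc k"] by (auto simp: w_Suc)
  qed
qed

lemma w_nonneg: "w k x \<ge> 0"
  using w_pos_iff by blast

end

section \<open>The Hardy-type inequality and summation by parts\<close>

context cumulative_ord begin

text \<open>For h = (x + 1)^m the top coefficient of \<open>T j h\<close> is positive, so by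
  \<open>w_T\<close> the drop of w_(j+1) (x + 1)^m from x to x + 1 eventually dominates a multiple
  of w_j (x + 1)^(m+1) at the next point. Multiplying by |f(x + 1)| <= |f(x)| + |\<Delta>f(x)| and
  telescoping gives the claim.\<close>

lemma hardy:
  assumes "1 - real (m + 2 * j) * \<delta> > 0"
    and sm: "summable (\<lambda>x. w (Suc j) x * (real x + 1) ^ m * \<bar>fwd_diff f x\<bar>)"
  shows "summable (\<lambda>x. w j x * (real x + 1) ^ Suc m * \<bar>f x\<bar>)"
proof -
  define h where "h = [:1::real, 1:] ^ m"
  have h: "degree h \<le> m" "coeff h m = 1" "poly h (real x) = (real x + 1) ^ m" for x
    using coeff_linear_power[of "1::real" m]
    by (auto simp: h_def degree_linear_power add.commute)
  obtain c x0 where c: "c > 0"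
      and ge: "\<And>x::nat. x \<ge> x0 \<Longrightarrow> c * (real x + 1) ^ Suc m \<le> poly (T j h) (real x)"
    using poly_eventually_ge_power[OF T_degree_coeff(1)[OF h(1), of j]] assms(1)
    by (auto simp: T_degree_coeff(2)[OF h(1)] h(2))
  define a where "a = (\<lambda>x. w (Suc j) x * (real x + 1) ^ m)"
  define u where "u = (\<lambda>x. w j x * (real x + 1) ^ Suc m)"
  have a0: "a x \<ge> 0" for x by (simp add: a_def w_nonneg)
  have cu: "c * u (Suc x) \<le> a x - a (Suc x)" if "x \<ge> x0" for x
  proof -
    have "c * u (Suc x) \<le> w j (Suc x) * poly (T j h) (real (Suc x))"
      using mult_left_mono[OF ge[of "Suc x"] w_nonneg[of j "Suc x"]] that
      by (simp add: u_def mult_ac)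
    also have "\<dots> = a x - a (Suc x)" by (subst w_T) (simp only: nat.case a_def h(3))
    finally show ?thesis .
  qed
  define B where "B = a x0 * \<bar>f x0\<bar> + (\<Sum>x. a x * \<bar>fwd_diff f x\<bar>)"
  \<comment> \<open>Keeping the nonnegative boundary term on the left makes the induction telescope;
    it is discarded afterwards.\<close>
  have step: "(\<Sum>i<N. c * u (Suc (x0 + i)) * \<bar>f (Suc (x0 + i))\<bar>) + a (x0 + N) * \<bar>f (x0 + N)\<bar>
      \<le> a x0 * \<bar>f x0\<bar> + (\<Sum>i<N. a (x0 + i) * \<bar>fwd_diff f (x0 + i)\<bar>)" for N
  proof (induction N)
    case (Suc N)
    let ?x = "x0 + N"
    have "c * u (Suc ?x) * \<bar>f (Suc ?x)\<bar> \<le> (a ?x - a (Suc ?x)) * \<bar>f (Suc ?x)\<bar>"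
      by (intro mult_right_mono cu) auto
    moreover have "a ?x * \<bar>f (Suc ?x)\<bar> \<le> a ?x * (\<bar>f ?x\<bar> + \<bar>fwd_diff f ?x\<bar>)"
      by (intro mult_left_mono a0) (simp add: fwd_diff_def)
    ultimately show ?case using Suc by (simp add: algebra_simps)
  qed simp
  have sma: "summable (\<lambda>x. a x * \<bar>fwd_diff f x\<bar>)" using sm by (simp add: a_def)
  have "(\<Sum>i<N. c * u (Suc (x0 + i)) * \<bar>f (Suc (x0 + i))\<bar>) \<le> B" for N
  proof -
    have "(\<Sum>i<N. a (x0 + i) * \<bar>fwd_diff f (x0 + i)\<bar>) =
        (\<Sum>x\<in>{x0..<x0+N}. a x * \<bar>fwd_diff f x\<bar>)"
      by (rule sum.reindex_bij_witness[where i = "\<lambda>x. x - x0" and j = "\<lambda>i. x0 + i"]) auto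
    also have "\<dots> \<le> (\<Sum>x. a x * \<bar>fwd_diff f x\<bar>)"
      by (intro sum_le_suminf sma) (auto simp: a0)
    finally show ?thesis using step[of N] mult_nonneg_nonneg[OF a0, of "\<bar>f (x0 + N)\<bar>" "x0 + N"]
      by (simp add: B_def)
  qed
  then have "summable (\<lambda>i. c * u (Suc (x0 + i)) * \<bar>f (Suc (x0 + i))\<bar>)"
    using c by (intro summableI_nonneg_bounded[where x = B]) (auto simp: u_def w_nonneg)
  then have "summable (\<lambda>i. inverse c * (c * u (Suc (x0 + i)) * \<bar>f (Suc (x0 + i))\<bar>))"
    by (rule summable_mult)
  moreover have "inverse c * (c * u (Suc (x0 + i)) * \<bar>f (Suc (x0 + i))\<bar>) =
      u (i + Suc x0) * \<bar>f (i + Suc x0)\<bar>" for i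
    using c by (simp add: add.commute)
  ultimately have "summable (\<lambda>i. u (i + Suc x0) * \<bar>f (i + Suc x0)\<bar>)" by (simp only:)
  then show ?thesis using summable_iff_shift[of "\<lambda>x. u x * \<bar>f x\<bar>" "Suc x0"] by (simp add: u_def)
qed

lemma summable_poly_times:
  assumes "degree h \<le> m" "summable (\<lambda>x. w j x * (real x + 1) ^ m * \<bar>f x\<bar>)"
  shows "summable (\<lambda>x. w j x * poly h (real x) * f x)"
proof -
  obtain C where C: "\<And>x::nat. \<bar>poly h (real x)\<bar> \<le> C * (real x + 1) ^ m"
    using poly_abs_le_power[OF assms(1)] by metis
  show ?thesis
  proof (rule summable_comparison_test'[OF summable_mult[OF assms(2), of C], of 0])
    fix x
    have "w j x * \<bar>f x\<bar> * \<bar>poly h (real x)\<bar> \<le> w j x * \<bar>f x\<bar> * (C * (real x + 1) ^ m)"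
      by (intro mult_left_mono C) (simp add: w_nonneg)
    then show "norm (w j x * poly h (real x) * f x) \<le> C * (w j x * (real x + 1) ^ m * \<bar>f x\<bar>)"
      by (simp add: abs_mult w_nonneg mult_ac)
  qed
qed

text \<open>The boundary term at \<open>N\<close> is at most \<open>N\<close> times a summable sequence, so its limit is \<open>0\<close>.\<close>

lemma summation_by_parts:
  assumes "degree h \<le> m"
    and sm: "summable (\<lambda>x. w j x * (real x + 1) ^ Suc m * \<bar>f x\<bar>)"
    and sm': "summable (\<lambda>x. w (Suc j) x * (real x + 1) ^ m * \<bar>fwd_diff f x\<bar>)"
  shows "(\<Sum>x. w j x * poly (T j h) (real x) * f x) =
    (\<Sum>x. w (Suc j) x * poly h (real x) * fwd_diff f x)"
proof -
  define b where "b = (\<lambda>x. w (Suc j) x * poly h (real x) * f x)"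
  define A where "A = (\<Sum>x. w j x * poly (T j h) (real x) * f x)"
  define B where "B = (\<Sum>x. w (Suc j) x * poly h (real x) * fwd_diff f x)"
  \<comment> \<open>The left sum has one term more, so that exactly one boundary term
    \<open>b N\<close> remains.\<close>
  have partial: "(\<Sum>x<Suc N. w j x * poly (T j h) (real x) * f x) =
      (\<Sum>x<N. w (Suc j) x * poly h (real x) * fwd_diff f x) - b N" for N
  proof (induction N)
    case 0
    show ?case using w_T[of j 0 h] by (simp add: b_def)
  next
    case (Suc N)
    show ?case
      by (subst sum.lessThan_Suc, subst Suc, subst w_T)
        (simp add: b_def fwd_diff_def algebra_simps)
  qed
  have "(\<lambda>N. \<Sum>x<N. w j x * poly (T j h) (real x) * f x) \<longlonglongrightarrow> A"
    unfolding A_def by (intro summable_LIMSEQ summable_poly_times[OF _ sm] T_degree_coeff assms)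
  then have "(\<lambda>N. \<Sum>x<Suc N. w j x * poly (T j h) (real x) * f x) \<longlonglongrightarrow> A"
    by (rule LIMSEQ_Suc)
  moreover have "(\<lambda>N. \<Sum>x<N. w (Suc j) x * poly h (real x) * fwd_diff f x) \<longlonglongrightarrow> B"
    unfolding B_def by (intro summable_LIMSEQ summable_poly_times[OF _ sm'] assms)
  ultimately have "(\<lambda>N. (\<Sum>x<N. w (Suc j) x * poly h (real x) * fwd_diff f x) -
      (\<Sum>x<Suc N. w j x * poly (T j h) (real x) * f x)) \<longlonglongrightarrow> B - A"
    by (intro tendsto_diff)
  then have b: "b \<longlonglongrightarrow> B - A" by (simp only: partial) simp
  have "B - A = 0"
  proof (rule ccontr)
    assume L: "B - A \<noteq> 0"
    have "degree (pcompose qpoly [:real j, 1:] * h) \<le> 2 + m"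
    proof -
      have "degree (pcompose qpoly [:real j, 1:]) \<le> 2" by (simp add: qpoly_def degree_pcompose)
      then show ?thesis using degree_mult_le[of "pcompose qpoly [:real j, 1:]" h] assms(1) by linarith
    qed
    then obtain C where C: "C \<ge> 0"
      "\<And>x::nat. \<bar>poly (pcompose qpoly [:real j, 1:] * h) (real x)\<bar> \<le> C * (real x + 1) ^ (2 + m)"
      using poly_abs_le_power by metis
    have bound: "\<bar>b x\<bar> \<le> (C * (w j x * (real x + 1) ^ Suc m * \<bar>f x\<bar>)) * (real x + 1)" for x
    proof -
      have "q (x + j) = poly (pcompose qpoly [:real j, 1:]) (real x)"
        using poly_qpoly[of "x + j"] by (simp add: poly_pcompose add.commute)
      then have "\<bar>b x\<bar> = \<bar>poly (pcompose qpoly [:real j, 1:] * h) (real x)\<bar> * (w j x * \<bar>f x\<bar>)"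
        by (simp add: b_def w_Suc abs_mult w_nonneg)
      also have "\<dots> \<le> C * (real x + 1) ^ (2 + m) * (w j x * \<bar>f x\<bar>)"
        by (intro mult_right_mono C) (simp add: w_nonneg)
      finally show ?thesis by (simp add: mult_ac)
    qed
    have "(\<lambda>x. \<bar>b x\<bar>) \<longlonglongrightarrow> \<bar>B - A\<bar>" by (intro tendsto_rabs b)
    then have "eventually (\<lambda>x. \<bar>b x\<bar> > \<bar>B - A\<bar> / 2) sequentially"
      using L by (intro order_tendstoD(1)) auto
    then obtain N where N: "\<And>x. x \<ge> N \<Longrightarrow> \<bar>b x\<bar> > \<bar>B - A\<bar> / 2"
      by (auto simp: eventually_sequentially)
    have "\<not> summable (\<lambda>x. C * (w j x * (real x + 1) ^ Suc m * \<bar>f x\<bar>))"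
    proof (rule not_summable_ge_harmonic[where c = "\<bar>B - A\<bar> / 2" and N = N])
      fix x assume "x \<ge> N"
      then have "\<bar>B - A\<bar> / 2 \<le> (C * (w j x * (real x + 1) ^ Suc m * \<bar>f x\<bar>)) * (real x + 1)"
        using N[of x] bound[of x] by linarith
      then show "\<bar>B - A\<bar> / 2 / (real x + 1) \<le> C * (w j x * (real x + 1) ^ Suc m * \<bar>f x\<bar>)"
        by (subst pos_divide_le_eq) auto
    qed (use L in auto)
    then show False using summable_mult[OF sm] by blast
  qed
  then show ?thesis by (simp add: A_def B_def)
qed

section \<open>Positivity of the factors 1 - i\<delta>\<close>

text \<open>For \<delta> > 0, compare slopes at the two ends of the support: \<open>q\<close> falls
  to 0 at the right end \<open>hi\<close>, while r rises from 0 at the left end \<open>lo\<close>.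
  Subtracting the two slope inequalities gives 2(hi - 1 - lo)\<delta> < 1, and k <= hi - lo.\<close>

lemma delta_factor_pos_of_finite_support:
  assumes "finite {x. p x > 0}" "p x > 0" "p (x + k) > 0" "k \<ge> 1" "i \<le> 2 * k - 2"
  shows "1 - real i * \<delta> > 0"
proof (cases "\<delta> \<le> 0")
  case True
  then show ?thesis using mult_nonneg_nonpos[of "real i" \<delta>] by simp
next
  case False
  define lo where "lo = Min {x. p x > 0}"
  define hi where "hi = Max {x. p x > 0}"
  have lo: "p lo > 0" "\<And>y. p y > 0 \<Longrightarrow> lo \<le> y"
    using Min_in[OF assms(1)] Min_le[OF assms(1)] assms(2) unfolding lo_def by auto
  have hi: "p hi > 0" "\<And>y. p y > 0 \<Longrightarrow> y \<le> hi"
    using Max_in[OF assms(1)] Max_ge[OF assms(1)] assms(2) unfolding hi_def by auto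
  have k: "lo + k \<le> hi" using lo(2)[OF assms(2)] hi(2)[OF assms(3)] by simp
  have "\<not> p (Suc hi) > 0" using hi(2)[of "Suc hi"] by auto
  then have qhi: "q hi = 0" using q_eq_0[OF hi(1)] p_nonneg[of "Suc hi"] by simp
  obtain y where y: "hi = Suc y" using k assms(4) by (cases hi) auto
  have "p y > 0" using support_interval[of lo y hi] lo hi k y assms(4) by simp
  then have qy: "q y > 0" using q_pos[of y hi] hi y by simp
  have "poly rpoly (real lo) * p lo = 0"
  proof (cases lo)
    case 0
    then show ?thesis using rpoly_p_0 by simp
  next
    case (Suc z)
    have "\<not> p z > 0" using lo(2)[of z] Suc by auto
    then have "p z = 0" using p_nonneg[of z] by simp
    then show ?thesis using rpoly_p_Suc[of z] Suc by simp
  qed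
  then have rlo: "poly rpoly (real lo) = 0" using lo by simp
  have pl: "p (Suc lo) > 0" using support_interval[of lo "Suc lo" hi] lo hi k assms(4) by simp
  have "q lo > 0" using q_pos[of lo hi] lo hi k assms(4) by simp
  then have "poly rpoly (real (Suc lo)) * p (Suc lo) > 0" using lo rpoly_p_Suc[of lo] by simp
  then have rl: "poly rpoly (real (Suc lo)) > 0" using pl by (simp add: zero_less_mult_iff)
  have "\<delta> * (2 * real y + 1) + \<beta> < 0"
    using qhi qy y by (simp add: q_eq algebra_simps power2_eq_square)
  moreover have "\<delta> * (2 * real lo + 1) + \<beta> + 1 > 0"
    using rl rlo by (simp add: rpoly_def algebra_simps)
  ultimately have "(2 * real y - 2 * real lo) * \<delta> < 1" by (simp add: algebra_simps)
  moreover have "real i \<le> 2 * real y - 2 * real lo"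
  proof -
    have "i + 2 * lo \<le> 2 * y" using assms(4,5) k y by linarith
    then have "real (i + 2 * lo) \<le> real (2 * y)" by (rule of_nat_mono)
    then show ?thesis by simp
  qed
  ultimately show ?thesis using mult_right_mono[of "real i" "2 * real y - 2 * real lo" \<delta>] False
    by linarith
qed

end

locale cumulative_ord_moment = cumulative_ord +
  fixes n :: nat
  assumes n_pos: "n \<ge> 1" and moment: "summable (\<lambda>x. p x * real x ^ (2 * n))"
begin

lemma moment_shifted: "summable (\<lambda>x. p x * (real x + 1) ^ (2 * n))"
proof (rule summable_comparison_test'[where N = 1])
  show "summable (\<lambda>x. 2 ^ (2 * n) * (p x * real x ^ (2 * n)))" by (intro summable_mult moment)
  fix x :: nat assume "x \<ge> 1"
  then have "(real x + 1) ^ (2 * n) \<le> (2 * real x) ^ (2 * n)" by (intro power_mono) auto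
  then have "p x * (real x + 1) ^ (2 * n) \<le> p x * (2 * real x) ^ (2 * n)"
    by (intro mult_left_mono p_nonneg)
  then show "norm (p x * (real x + 1) ^ (2 * n)) \<le> 2 ^ (2 * n) * (p x * real x ^ (2 * n))"
    by (simp add: p_nonneg power_mult_distrib mult_ac)
qed

text \<open>If \<open>(2n-1)\<delta> > 1\<close>, then \<open>x \<mapsto> w 1 x (x+1)^(2n-1)\<close> is eventually increasing, so
  \<open>p x (x+1)^(2n)\<close> is bounded below by a multiple of \<open>1/x\<close>.\<close>

lemma delta_le_of_infinite_support:
  assumes "infinite {x. p x > 0}"
  shows "real (2 * n - 1) * \<delta> \<le> 1"
proof (rule ccontr)
  assume d: "\<not> real (2 * n - 1) * \<delta> \<le> 1"
  define m where "m = 2 * n - 1"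
  define h where "h = [:1::real, 1:] ^ m"
  have h: "degree h \<le> m" "coeff h m = 1" "poly h (real x) = (real x + 1) ^ m" for x
    using coeff_linear_power[of "1::real" m]
    by (auto simp: h_def degree_linear_power add.commute)
  have deg: "degree (- T 0 h) \<le> Suc m" using T_degree_coeff(1)[OF h(1)] by simp
  have "coeff (- T 0 h) (Suc m) > 0"
    unfolding coeff_minus T_degree_coeff(2)[OF h(1)] h(2) using d unfolding m_def[symmetric] by simp
  from poly_eventually_ge_power[OF deg this] obtain c x0 where c: "c > 0"
    and ge: "\<And>x::nat. x \<ge> x0 \<Longrightarrow> c * (real x + 1) ^ Suc m \<le> poly (- T 0 h) (real x)" by metis
  define a where "a = (\<lambda>x. w 1 x * (real x + 1) ^ m)"
  have inc: "a x \<le> a (Suc x)" if "x \<ge> x0" for x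
  proof -
    have "0 \<le> c * (real (Suc x) + 1) ^ Suc m" using c by simp
    with ge[of "Suc x"] that have "poly (T 0 h) (real (Suc x)) \<le> 0" by simp
    then have "w 0 (Suc x) * poly (T 0 h) (real (Suc x)) \<le> 0"
      by (intro mult_nonneg_nonpos w_nonneg)
    also have "w 0 (Suc x) * poly (T 0 h) (real (Suc x)) = a x - a (Suc x)"
      by (subst w_T) (simp only: nat.case a_def h(3) One_nat_def)
    finally show ?thesis by simp
  qed
  \<comment> \<open>A starting point in the monotone range with \<open>x1 + 1\<close> still in the
    support, which makes \<open>a x1\<close> strictly positive.\<close>
  obtain x1 where x1: "x1 \<ge> x0" "p x1 > 0"
    using assms by (auto simp: infinite_nat_iff_unbounded_le)
  obtain z where "z > x1" "p z > 0"
    using assms by (auto simp: infinite_nat_iff_unbounded)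
  then have "p (x1 + 1) > 0" using support_interval[of x1 "x1 + 1" z] x1 by simp
  then have a1: "a x1 > 0" using w_pos_iff[of 1 x1] x1 by (simp add: a_def)
  have mono: "a x1 \<le> a x" if "x \<ge> x1" for x
    using that
  proof (induction x rule: dec_induct)
    case (step y)
    then show ?case using inc[of y] x1(1) by linarith
  qed simp
  have "degree qpoly \<le> 2" by (simp add: qpoly_def)
  from poly_abs_le_power[OF this] obtain C
    where C: "C \<ge> 0" "\<And>x::nat. \<bar>poly qpoly (real x)\<bar> \<le> C * (real x + 1) ^ 2" by metis
  have "\<not> summable (\<lambda>x. C * (p x * (real x + 1) ^ (2 * n)))"
  proof (rule not_summable_ge_harmonic[OF a1, of x1])
    fix x assume x: "x \<ge> x1"
    have "a x \<le> (C * (real x + 1) ^ 2) * p x * (real x + 1) ^ m"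
      unfolding a_def using C(2)[of x] w_Suc[of 0 x]
      by (auto simp: w_0 poly_qpoly intro!: mult_right_mono p_nonneg)
    also have "\<dots> = C * (p x * (real x + 1) ^ (2 * n)) * (real x + 1)"
    proof -
      have "Suc m = 2 * n" using n_pos by (simp add: m_def)
      then have "(real x + 1) ^ (2 * n) = (real x + 1) ^ m * (real x + 1)"
        by (metis power_Suc2)
      then show ?thesis by (simp add: power2_eq_square)
    qed
    finally show "a x1 / (real x + 1) \<le> C * (p x * (real x + 1) ^ (2 * n))"
      using mono[OF x] by (subst pos_divide_le_eq) auto
  qed
  then show False using summable_mult[OF moment_shifted] by blast
qed

text \<open>With infinite support only the weak bound (2n - 1)\<delta> <= 1 is available; strictness
  comes from i <= 2k - 2 < 2n - 1.\<close>

lemma delta_factor_pos: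
  assumes "w k x \<noteq> 0" "1 \<le> k" "k \<le> n" "i \<le> 2 * k - 2"
  shows "1 - real i * \<delta> > 0"
proof (cases "finite {x. p x > 0}")
  case True
  have "p x > 0" "p (x + k) > 0" using assms(1) w_pos_iff[of k x] by auto
  then show ?thesis using delta_factor_pos_of_finite_support[OF True] assms by blast
next
  case False
  note le = delta_le_of_infinite_support[OF this]
  show ?thesis
  proof (cases "\<delta> \<le> 0")
    case True
    then show ?thesis using mult_nonneg_nonpos[of "real i" \<delta>] by simp
  next
    case False
    have "real i * \<delta> < real (2 * n - 1) * \<delta>" using False assms n_pos by (intro mult_strict_right_mono) auto
    with le show ?thesis by simp
  qed
qed

end

section \<open>Iterated differences of polynomials\<close>

definition poly_diff :: "real poly \<Rightarrow> real poly" where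
  "poly_diff h = pcompose h [:1, 1:] - h"

lemma fwd_diff_funpow_poly:
  "(fwd_diff ^^ k) (\<lambda>x. poly h (real x)) = (\<lambda>x. poly ((poly_diff ^^ k) h) (real x))"
  by (induction k) (auto simp: fwd_diff_def poly_diff_def poly_pcompose add.commute)

text \<open>Each difference lowers the degree bound by one and multiplies the top coefficient by the
  old bound. The total factor m!/(m - k)! is written without division.\<close>

lemma poly_diff_funpow_degree_coeff:
  assumes "degree h \<le> m" "k \<le> m"
  shows "degree ((poly_diff ^^ k) h) \<le> m - k \<and>
    coeff ((poly_diff ^^ k) h) (m - k) * fact (m - k) = fact m * coeff h m"
  using assms(2)
proof (induction k)
  case (Suc k)
  define f where "f = (poly_diff ^^ k) h"
  have f: "degree f \<le> m - k" "coeff f (m - k) * fact (m - k) = fact m * coeff h m"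
    using Suc by (auto simp: f_def)
  have d: "\<And>i. i \<ge> m - k \<Longrightarrow> coeff (poly_diff f) i = 0"
    "coeff (poly_diff f) (m - k - 1) = real (m - k) * coeff f (m - k)"
    using coeff_pcompose_shift_diff[OF f(1), of 1] by (auto simp: poly_diff_def)
  obtain l where l: "m - k = Suc l" using Suc.prems by (cases "m - k") auto
  then have l': "m - Suc k = l" by simp
  have "degree (poly_diff f) \<le> l"
  proof (rule degree_le, intro allI impI)
    fix i assume "l < i" then show "coeff (poly_diff f) i = 0" using d(1) l by simp
  qed
  moreover have "coeff (poly_diff f) l * fact l = fact m * coeff h m"
    using d(2) f(2) unfolding l by (simp add: mult_ac)
  ultimately show ?case unfolding l' by (simp add: f_def)
qed (use assms in simp)

text \<open>The product of the linear factors X - (a + i); it annihilates a support of at most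
  \<open>m\<close> points.\<close>

lemma exists_monic_vanishing:
  obtains R :: "real poly" where "degree R \<le> m" "coeff R m = 1" "\<And>i. i < m \<Longrightarrow> poly R (a + real i) = 0"
proof -
  have "\<exists>R :: real poly. degree R \<le> m \<and> coeff R m = 1 \<and> (\<forall>i<m. poly R (a + real i) = 0)"
  proof (induction m)
    case (Suc m)
    then obtain R :: "real poly" where R: "degree R \<le> m" "coeff R m = 1" "\<forall>i<m. poly R (a + real i) = 0"
      by blast
    have l: "degree [:- (a + real m), 1:] \<le> 1" "coeff [:- (a + real m), 1:] 1 = 1" by auto
    show ?case
    proof (intro exI[of _ "[:- (a + real m), 1:] * R"] conjI)
      show "degree ([:- (a + real m), 1:] * R) \<le> Suc m"
        using degree_mult_le[of "[:- (a + real m), 1:]" R] l R by linarith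
      show "coeff ([:- (a + real m), 1:] * R) (Suc m) = 1"
        using coeff_mult_degree_le[OF l(1) R(1)] l(2) R(2) by simp
      show "\<forall>i<Suc m. poly ([:- (a + real m), 1:] * R) (a + real i) = 0"
        using R(3) by (simp add: less_Suc_eq algebra_simps)
    qed
  qed (auto intro: exI[of _ 1])
  then show ?thesis using that by blast
qed

section \<open>Orthogonality of the Rodrigues polynomials\<close>

context cumulative_ord_moment begin

text \<open>For k <= n this is E[q^[k](X)].\<close>

definition W :: "nat \<Rightarrow> real" where "W k = (\<Sum>x. w k x)"

text \<open>As a polynomial in x, q^[k](x) has degree at most 2k, so the moment of order 2n
  dominates.\<close>

lemma summable_w_power:
  assumes "2 * k + d \<le> 2 * n"
  shows "summable (\<lambda>x. w k x * (real x + 1) ^ d)"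
proof -
  define h where "h = (\<Prod>i<k. pcompose qpoly [:real i, 1:])"
  have "degree h \<le> (\<Sum>i<k. degree (pcompose qpoly [:real i, 1:]))"
    unfolding h_def using degree_prod_sum_le[of "{..<k}"] by (simp add: o_def)
  also have "\<dots> \<le> (\<Sum>i<k. 2)" by (intro sum_mono) (simp add: qpoly_def degree_pcompose)
  finally have "degree h \<le> 2 * k" by simp
  from poly_abs_le_power[OF this] obtain C
    where C: "C \<ge> 0" "\<And>x::nat. \<bar>poly h (real x)\<bar> \<le> C * (real x + 1) ^ (2 * k)" by metis
  have h: "poly h (real x) = rising_prod q k x" for x
    using poly_qpoly[of "x + _"]
    by (auto simp: h_def rising_prod_def poly_prod poly_pcompose add.commute intro!: prod.cong)
  show ?thesis
  proof (rule summable_comparison_test'[OF summable_mult[OF moment_shifted, of C], of 0])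
    fix x
    have "w k x * (real x + 1) ^ d \<le> C * (real x + 1) ^ (2 * k) * p x * (real x + 1) ^ d"
      using C(2)[of x] unfolding w_def h by (intro mult_right_mono p_nonneg) auto
    also have "\<dots> = C * p x * (real x + 1) ^ (2 * k + d)" by (simp add: power_add)
    also have "\<dots> \<le> C * p x * (real x + 1) ^ (2 * n)"
      using assms C p_nonneg by (intro mult_left_mono power_increasing) auto
    finally show "norm (w k x * (real x + 1) ^ d) \<le> C * (p x * (real x + 1) ^ (2 * n))"
      by (simp add: w_nonneg)
  qed
qed

lemma summable_p_poly:
  assumes "degree h \<le> 2 * n"
  shows "summable (\<lambda>x. p x * poly h (real x))"
  using summable_poly_times[OF assms, of 0 "\<lambda>_. 1"] summable_w_power[of 0 "2 * n"] by (simp add: w_0)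

lemma w_sums: "k \<le> n \<Longrightarrow> w k sums W k"
  using summable_w_power[of k 0] by (simp add: W_def summable_sums)

lemma W_0: "W 0 = 1"
  using p_sums by (simp add: W_def w_0 sums_iff)

lemma W_nonneg: "k \<le> n \<Longrightarrow> W k \<ge> 0"
  using w_sums w_nonneg by (metis sums_le sums_zero)

lemma W_eq_0: "k \<le> n \<Longrightarrow> W k = 0 \<Longrightarrow> w k x = 0"
  using suminf_eq_zero_iff[of "w k"] w_sums[of k] w_nonneg[of k] by (simp add: W_def sums_iff)

lemma W_nonzeroE:
  assumes "W k \<noteq> 0"
  obtains x where "w k x \<noteq> 0"
  using assms that by (cases "\<forall>x. w k x = 0") (auto simp: W_def)

text \<open>Descends from level k to level j by \<open>hardy\<close>, trading each difference for
  one power of x + 1.\<close>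

lemma summable_stage:
  assumes "k \<le> n" "W k \<noteq> 0" and sm: "summable (\<lambda>x. w k x * \<bar>(fwd_diff ^^ k) f x\<bar>)"
    and "j + i = k"
  shows "summable (\<lambda>x. w j x * (real x + 1) ^ i * \<bar>(fwd_diff ^^ j) f x\<bar>)"
  using assms(4)
proof (induction i arbitrary: j)
  case 0
  then show ?case using sm by simp
next
  case (Suc i)
  obtain x where "w k x \<noteq> 0" using assms(2) W_nonzeroE by blast
  \<comment> \<open>Since j + i + 1 = k, the index i + 2j equals k - 1 + j and is at most 2k -
    2.\<close>
  then have "1 - real (i + 2 * j) * \<delta> > 0" using Suc.prems assms(1) by (intro delta_factor_pos) auto
  moreover have "summable (\<lambda>x. w (Suc j) x * (real x + 1) ^ i * \<bar>fwd_diff ((fwd_diff ^^ j) f) x\<bar>)"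
    using Suc.IH[of "Suc j"] Suc.prems by simp
  ultimately show ?case by (rule hardy)
qed

lemma rodrigues_sums:
  assumes "k \<le> n" "W k \<noteq> 0" and sm: "summable (\<lambda>x. w k x * \<bar>(fwd_diff ^^ k) f x\<bar>)"
  shows "(\<lambda>x. p x * poly (rodrigues 0 k) (real x) * f x) sums (\<Sum>x. w k x * (fwd_diff ^^ k) f x)"
proof -
  \<comment> \<open>Intermediate stage with \<open>j\<close> differences on \<open>f\<close> and
    \<open>i\<close> operators \<open>T\<close> left to move; j = 0 is the identity sought.\<close>
  have eq: "(\<Sum>x. w j x * poly (rodrigues j i) (real x) * (fwd_diff ^^ j) f x) =
      (\<Sum>x. w k x * (fwd_diff ^^ k) f x)" if "j + i = k" for i j
    using that
  proof (induction i arbitrary: j)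
    case (Suc i)
    have "(\<Sum>x. w j x * poly (rodrigues j (Suc i)) (real x) * (fwd_diff ^^ j) f x) =
        (\<Sum>x. w (Suc j) x * poly (rodrigues (Suc j) i) (real x) * fwd_diff ((fwd_diff ^^ j) f) x)"
      unfolding rodrigues.simps
      using summable_stage[OF assms, of j "Suc i"] summable_stage[OF assms, of "Suc j" i] Suc.prems
      by (intro summation_by_parts[OF rodrigues_degree]) auto
    also have "\<dots> = (\<Sum>x. w k x * (fwd_diff ^^ k) f x)" using Suc.IH[of "Suc j"] Suc.prems by simp
    finally show ?case .
  qed simp
  have "summable (\<lambda>x. w 0 x * poly (rodrigues 0 k) (real x) * (fwd_diff ^^ 0) f x)"
    by (intro summable_poly_times[OF rodrigues_degree] summable_stage[OF assms]) simp
  then show ?thesis using eq[of 0 k] by (simp add: w_0 sums_iff)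
qed

text \<open>The k-th difference of a polynomial of degree at most k is the constant k! times its
  coefficient at k, which is 0 for lower degree.\<close>

lemma rodrigues_poly_sums:
  assumes "k \<le> n" "W k \<noteq> 0" "degree h \<le> k"
  shows "(\<lambda>x. p x * poly (rodrigues 0 k) (real x) * poly h (real x)) sums
    (fact k * W k * coeff h k)"
proof -
  define H where "H = (poly_diff ^^ k) h"
  have H: "degree H = 0" "coeff H 0 = fact k * coeff h k"
    using poly_diff_funpow_degree_coeff[OF assms(3) order.refl] by (auto simp: H_def)
  from H(1) obtain c where "H = [:c:]" by (rule degree_eq_zeroE)
  with H(2) have D: "(fwd_diff ^^ k) (\<lambda>x. poly h (real x)) x = fact k * coeff h k" for x
    unfolding fwd_diff_funpow_poly H_def[symmetric] by simp
  have "summable (w k)" using w_sums[OF assms(1)] by (simp add: sums_iff)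
  then have "summable (\<lambda>x. w k x * \<bar>(fwd_diff ^^ k) (\<lambda>x. poly h (real x)) x\<bar>)"
    unfolding D by (rule summable_mult2)
  from rodrigues_sums[OF assms(1,2) this]
  show ?thesis unfolding D
    using suminf_mult2[OF \<open>summable (w k)\<close>, of "fact k * coeff h k"] by (simp add: W_def mult_ac)
qed

text \<open>E[P_k(X)^2] by \<open>rodrigues_orthogonal\<close>, when k <= n and \<open>W k\<close>
  is nonzero; for k >= 1 it is the denominator in the bound.\<close>

definition sqnorm :: "nat \<Rightarrow> real" where
  "sqnorm k = fact k * W k * coeff (rodrigues 0 k) k"

lemma sqnorm_pos:
  assumes "k \<le> n" "W k \<noteq> 0"
  shows "sqnorm k > 0"
proof -
  obtain x where x: "w k x \<noteq> 0" using assms(2) W_nonzeroE by blast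
  have "coeff (rodrigues 0 k) k > 0"
  proof (cases "k = 0")
    case False
    then have "k \<ge> 1" by simp
    then show ?thesis unfolding rodrigues_0_coeff[OF \<open>k \<ge> 1\<close>]
      using delta_factor_pos[OF x _ assms(1)] by (intro prod_pos) auto
  qed simp
  then show ?thesis using W_nonneg[OF assms(1)] assms(2) by (simp add: sqnorm_def)
qed

text \<open>The polynomial of larger index is the one whose operators are moved; the other is then
  differenced down to a constant.\<close>

lemma rodrigues_orthogonal:
  assumes "k \<le> n" "W k \<noteq> 0" "l \<le> n" "W l \<noteq> 0"
  shows "(\<lambda>x. p x * poly (rodrigues 0 k) (real x) * poly (rodrigues 0 l) (real x)) sums
    (if k = l then sqnorm k else 0)"
proof (cases "l \<le> k")
  case True
  then have "degree (rodrigues 0 l) \<le> k" using rodrigues_degree[of 0 l] by simp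
  moreover have "k \<noteq> l \<Longrightarrow> coeff (rodrigues 0 l) k = 0"
    using True rodrigues_degree[of 0 l] by (intro coeff_eq_0) simp
  ultimately show ?thesis using rodrigues_poly_sums[OF assms(1,2)] by (fastforce simp: sqnorm_def)
next
  case False
  then have "degree (rodrigues 0 k) \<le> l" "coeff (rodrigues 0 k) l = 0"
    using rodrigues_degree[of 0 k] by (auto intro: coeff_eq_0)
  then show ?thesis using rodrigues_poly_sums[OF assms(3,4), of "rodrigues 0 k"] False
    by (simp add: mult_ac)
qed

text \<open>When \<open>W m = 0\<close> the support has at most \<open>m\<close> points, and a monic polynomial vanishing there
  takes the place of the degree-\<open>m\<close> orthogonal polynomial.\<close>

lemma exists_orthogonal_degree:
  assumes "m \<le> n"
    and orth: "\<And>k. k \<le> n \<Longrightarrow> W k \<noteq> 0 \<Longrightarrow> (\<lambda>x. p x * G x * poly (rodrigues 0 k) (real x)) sums 0"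
  obtains R where "degree R \<le> m" "coeff R m \<noteq> 0" "(\<lambda>x. p x * G x * poly R (real x)) sums 0"
proof (cases "W m = 0")
  case False
  have "coeff (rodrigues 0 m) m \<noteq> 0" using sqnorm_pos[OF assms(1) False] by (auto simp: sqnorm_def)
  then show ?thesis using that[OF rodrigues_degree _ orth[OF assms(1) False]] by blast
next
  case True
  have "\<exists>x. p x > 0"
  proof (rule ccontr)
    assume "\<not> ?thesis"
    then have "p = (\<lambda>x. 0)" using p_nonneg by (force simp: less_le)
    then show False using p_sums sums_unique2 sums_zero by fastforce
  qed
  define lo where "lo = (LEAST x. p x > 0)"
  have lo: "p lo > 0" "\<And>x. p x > 0 \<Longrightarrow> lo \<le> x"
    unfolding lo_def using \<open>\<exists>x. p x > 0\<close> by (auto intro: LeastI_ex Least_le)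
  have up: "x < lo + m" if "p x > 0" for x
  proof (rule ccontr)
    assume "\<not> x < lo + m"
    then have "p (lo + m) > 0" using support_interval[of lo "lo + m" x] lo that by simp
    then have "w m lo > 0" using w_pos_iff[of m lo] lo by simp
    then show False using W_eq_0[OF assms(1) True] by simp
  qed
  obtain R :: "real poly" where R: "degree R \<le> m" "coeff R m = 1"
      "\<And>i. i < m \<Longrightarrow> poly R (real lo + real i) = 0"
    using exists_monic_vanishing by metis
  have "p x * G x * poly R (real x) = 0" for x
  proof (cases "p x > 0")
    case True
    then have "x = lo + (x - lo)" "x - lo < m" using lo(2) up by fastforce+
    then have "poly R (real x) = 0" using R(3)[of "x - lo"] by (metis of_nat_add)
    then show ?thesis by simp
  qed (use p_nonneg[of x] in simp)
  then have "(\<lambda>x. p x * G x * poly R (real x)) sums 0" by (simp only: sums_zero)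
  then show ?thesis using that[of R] R by simp
qed

text \<open>Test polynomials of every exact degree up to \<open>n\<close> span, so the top
  coefficient of \<open>h\<close> can be removed repeatedly.\<close>

lemma orthogonal_all_poly:
  assumes orth: "\<And>k. k \<le> n \<Longrightarrow> W k \<noteq> 0 \<Longrightarrow> (\<lambda>x. p x * G x * poly (rodrigues 0 k) (real x)) sums 0"
    and "degree h \<le> n"
  shows "(\<lambda>x. p x * G x * poly h (real x)) sums 0"
proof -
  \<comment> \<open>Here \<open>m\<close> is a strict bound on the degree, so that m = 0 means h = 0
    and the goal is m = n + 1.\<close>
  have "(\<lambda>x. p x * G x * poly h (real x)) sums 0"
    if "m \<le> Suc n" "\<And>i. i \<ge> m \<Longrightarrow> coeff h i = 0" for m h
    using that
  proof (induction m arbitrary: h)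
    case 0
    then have "h = 0" by (intro poly_eqI) simp
    then show ?case by simp
  next
    case (Suc m)
    then have "m \<le> n" by simp
    obtain R where R: "degree R \<le> m" "coeff R m \<noteq> 0" "(\<lambda>x. p x * G x * poly R (real x)) sums 0"
      using exists_orthogonal_degree[OF \<open>m \<le> n\<close> orth] by metis
    define c where "c = coeff h m / coeff R m"
    have "(\<lambda>x. p x * G x * poly (h - smult c R) (real x)) sums 0"
    proof (rule Suc.IH)
      fix i assume "m \<le> i"
      then show "coeff (h - smult c R) i = 0"
        using R Suc.prems(2)[of i] by (cases "i = m") (auto simp: c_def coeff_eq_0)
    qed (use \<open>m \<le> n\<close> in simp)
    from sums_add[OF this sums_mult[OF R(3), of c]] show ?case by (simp add: algebra_simps)
  qed
  from this[of "Suc n" h] show ?thesis using assms(2) by (simp add: coeff_eq_0)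
qed

section \<open>Bessel's inequality and the case of equality\<close>

text \<open>Shows that infinite variance excludes \<open>g\<close> from being a polynomial of degree
  at most \<open>n\<close> on the support.\<close>

lemma summable_poly_square:
  assumes "degree P \<le> n" "\<And>x. p x > 0 \<Longrightarrow> g x = poly P (real x)"
  shows "summable (\<lambda>x. p x * (g x)\<^sup>2)"
proof -
  have "degree (P ^ 2) \<le> 2 * n" using degree_power_le[of P 2] assms(1) by linarith
  then have "summable (\<lambda>x. p x * poly (P ^ 2) (real x))" by (rule summable_p_poly)
  moreover have "p x * poly (P ^ 2) (real x) = p x * (g x)\<^sup>2" for x
    using assms(2)[of x] p_nonneg[of x] by (cases "p x = 0") auto
  ultimately show ?thesis by (simp only:)
qed

text \<open>V - B is the mean square of the residual \<open>G\<close> of \<open>g\<close> after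
  projection, which is 0 exactly when \<open>g\<close> equals its projection on the support.\<close>

lemma bessel:
  assumes sq: "summable (\<lambda>x. p x * (g x)\<^sup>2)"
    and sm: "\<And>k. k \<le> n \<Longrightarrow> summable (\<lambda>x. w k x * \<bar>(fwd_diff ^^ k) g x\<bar>)"
  defines "e \<equiv> \<lambda>k. \<Sum>x. w k x * (fwd_diff ^^ k) g x"
  defines "B \<equiv> \<Sum>k=1..n. if W k = 0 then 0 else
      (e k)\<^sup>2 / (fact k * W k * (\<Prod>j=k-1..2*k-2. 1 - real j * \<delta>))"
  defines "V \<equiv> (\<Sum>x. p x * (g x)\<^sup>2) - (\<Sum>x. p x * g x)\<^sup>2"
  shows "B \<le> V"
    and "V = B \<longleftrightarrow> (\<exists>P. degree P \<le> n \<and> (\<forall>x. p x > 0 \<longrightarrow> g x = poly P (real x)))"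
proof -
  define S where "S = {k. k \<le> n \<and> W k \<noteq> 0}"
  have finS: "finite S" unfolding S_def by (rule finite_subset[of _ "{..n}"]) auto
  have Npos: "k \<in> S \<Longrightarrow> sqnorm k > 0" for k using sqnorm_pos by (simp add: S_def)
  have e: "(\<lambda>x. p x * poly (rodrigues 0 k) (real x) * g x) sums e k" if "k \<in> S" for k
    using rodrigues_sums[OF _ _ sm] that by (auto simp: S_def e_def)
  \<comment> \<open>The orthogonal projection of \<open>g\<close> onto polynomials of degree at most
    \<open>n\<close>; indices with \<open>W k = 0\<close>, where \<open>sqnorm k = 0\<close>, are
    left out.\<close>
  define Q where "Q = (\<Sum>k\<in>S. smult (e k / sqnorm k) (rodrigues 0 k))"
  have Q: "poly Q x = (\<Sum>k\<in>S. e k / sqnorm k * poly (rodrigues 0 k) x)" for x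
    by (simp add: Q_def poly_sum)
  have degQ: "degree Q \<le> n" unfolding Q_def
    using rodrigues_degree by (intro degree_sum_le finS)
      (force simp: S_def intro: order_trans[OF degree_smult_le] order_trans[OF rodrigues_degree])
  define G where "G = (\<lambda>x. g x - poly Q (real x))"
  have orth: "(\<lambda>x. p x * G x * poly (rodrigues 0 l) (real x)) sums 0" if "l \<in> S" for l
  proof -
    have "(\<lambda>x. \<Sum>k\<in>S. e k / sqnorm k * (p x * poly (rodrigues 0 k) (real x) * poly (rodrigues 0 l) (real x)))
        sums (\<Sum>k\<in>S. e k / sqnorm k * (if k = l then sqnorm k else 0))"
      using that by (intro sums_sum sums_mult rodrigues_orthogonal) (auto simp: S_def)
    also have "(\<Sum>k\<in>S. e k / sqnorm k * (if k = l then sqnorm k else 0)) = e l"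
      using that finS Npos[OF that] by (simp add: if_distrib[of "\<lambda>x. _ * x"] sum.delta cong: if_cong)
    finally have "(\<lambda>x. p x * poly (rodrigues 0 l) (real x) * g x -
        (\<Sum>k\<in>S. e k / sqnorm k * (p x * poly (rodrigues 0 k) (real x) * poly (rodrigues 0 l) (real x))))
        sums (e l - e l)"
      using e[OF that] by (intro sums_diff)
    then show ?thesis
      by (simp add: G_def Q algebra_simps sum_distrib_left sum_distrib_right)
  qed
  have GQ: "(\<lambda>x. p x * G x * poly Q (real x)) sums 0"
    by (rule orthogonal_all_poly[OF orth degQ]) (simp add: S_def)
  have "(\<lambda>x. \<Sum>k\<in>S. e k / sqnorm k * (p x * poly (rodrigues 0 k) (real x) * g x)) sums
      (\<Sum>k\<in>S. e k / sqnorm k * e k)"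
    by (intro sums_sum sums_mult e)
  then have gQ: "(\<lambda>x. p x * g x * poly Q (real x)) sums (\<Sum>k\<in>S. (e k)\<^sup>2 / sqnorm k)"
    by (simp add: Q algebra_simps sum_distrib_left power2_eq_square)
  have "(\<lambda>x. p x * (g x)\<^sup>2 - p x * g x * poly Q (real x) - p x * G x * poly Q (real x)) sums
      ((\<Sum>x. p x * (g x)\<^sup>2) - (\<Sum>k\<in>S. (e k)\<^sup>2 / sqnorm k) - 0)"
    by (intro sums_diff GQ gQ summable_sums sq)
  moreover have "p x * (g x)\<^sup>2 - p x * g x * poly Q (real x) - p x * G x * poly Q (real x) =
      p x * (G x)\<^sup>2" for x
    by (simp add: G_def power2_eq_square algebra_simps)
  ultimately have G2: "(\<lambda>x. p x * (G x)\<^sup>2) sums ((\<Sum>x. p x * (g x)\<^sup>2) - (\<Sum>k\<in>S. (e k)\<^sup>2 / sqnorm k))"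
    by simp
  \<comment> \<open>P_0 = 1 contributes the squared mean, which turns the second moment into the
    variance.\<close>
  have "S = insert 0 {k \<in> {1..n}. W k \<noteq> 0}" by (auto simp: S_def W_0)
  then have "(\<Sum>k\<in>S. (e k)\<^sup>2 / sqnorm k) = (e 0)\<^sup>2 / sqnorm 0 + (\<Sum>k\<in>{k \<in> {1..n}. W k \<noteq> 0}. (e k)\<^sup>2 / sqnorm k)"
    by simp
  also have "(e 0)\<^sup>2 / sqnorm 0 = (\<Sum>x. p x * g x)\<^sup>2" by (simp add: e_def sqnorm_def W_0 w_0)
  also have "(\<Sum>k\<in>{k \<in> {1..n}. W k \<noteq> 0}. (e k)\<^sup>2 / sqnorm k) = B"
    unfolding B_def
    by (subst sum.inter_filter) (auto intro!: sum.cong simp: sqnorm_def rodrigues_0_coeff)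
  finally have G2V: "(\<lambda>x. p x * (G x)\<^sup>2) sums (V - B)" using G2 by (simp add: V_def algebra_simps)
  have nn: "0 \<le> p x * (G x)\<^sup>2" for x by (simp add: p_nonneg)
  show "B \<le> V" using sums_le[OF nn sums_zero G2V] by simp
  have "V = B \<longleftrightarrow> (\<forall>x. p x * (G x)\<^sup>2 = 0)"
    using suminf_eq_zero_iff[OF sums_summable[OF G2V] nn] sums_unique[OF G2V] by auto
  also have "\<dots> \<longleftrightarrow> (\<forall>x. p x > 0 \<longrightarrow> g x = poly Q (real x))"
    using p_nonneg by (auto simp: G_def less_le)
  finally have VB: "V = B \<longleftrightarrow> (\<forall>x. p x > 0 \<longrightarrow> g x = poly Q (real x))" .
  also have "\<dots> \<longleftrightarrow> (\<exists>P. degree P \<le> n \<and> (\<forall>x. p x > 0 \<longrightarrow> g x = poly P (real x)))"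
  proof
    assume "\<exists>P. degree P \<le> n \<and> (\<forall>x. p x > 0 \<longrightarrow> g x = poly P (real x))"
    then obtain P where P: "degree P \<le> n" "\<And>x. p x > 0 \<Longrightarrow> g x = poly P (real x)" by blast
    \<comment> \<open>On the support \<open>G\<close> agrees with P - Q, hence \<open>G\<close> is
      orthogonal to itself.\<close>
    have "(\<lambda>x. p x * G x * poly (P - Q) (real x)) sums 0"
      by (rule orthogonal_all_poly[OF orth degree_diff_le[OF P(1) degQ]]) (simp add: S_def)
    moreover have "p x * G x * poly (P - Q) (real x) = p x * (G x)\<^sup>2" for x
      using P(2)[of x] p_nonneg[of x] by (cases "p x = 0") (auto simp: G_def power2_eq_square)
    ultimately have "V - B = 0" using sums_unique2[OF G2V] by (simp only:)
    then show "\<forall>x. p x > 0 \<longrightarrow> g x = poly Q (real x)"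
      using VB by simp
  qed (use degQ in blast)
  finally show "V = B \<longleftrightarrow> (\<exists>P. degree P \<le> n \<and> (\<forall>x. p x > 0 \<longrightarrow> g x = poly P (real x)))" .
qed

end

section \<open>From series back to expectations and the extended variance\<close>

theorem theorem4p1:
  fixes M :: "'a measure" and X :: "'a \<Rightarrow> nat" and p q g :: "nat \<Rightarrow> real"
    and \<mu> \<delta> \<beta> \<gamma> :: real and J :: "nat set" and n :: nat
  assumes "prob_space M"
    and "X \<in> measurable M (count_space UNIV)"
    and "\<And>x. p x = \<P>(\<omega> in M. X \<omega> = x)"
    and "integrable M (\<lambda>\<omega>. real (X \<omega>))"
    and "\<mu> = prob_space.expectation M (\<lambda>\<omega>. real (X \<omega>))"
    and "\<And>x. q x = \<delta> * (real x)\<^sup>2 + \<beta> * real x + \<gamma>"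
    and "\<And>x. (\<Sum>j=0..x. (\<mu> - real j) * p j) = q x * p x"
    and "J = {x. p x > 0}"
    and "n \<ge> 1"
    and "integrable M (\<lambda>\<omega>. real (X \<omega>) ^ (2 * n))"
    and "\<And>k. k \<le> n \<Longrightarrow>
           integrable M (\<lambda>\<omega>. rising_prod q k (X \<omega>) * \<bar>(fwd_diff ^^ k) g (X \<omega>)\<bar>)"
  defines "B \<equiv> (\<Sum>k=1..n.
      if prob_space.expectation M (\<lambda>\<omega>. rising_prod q k (X \<omega>)) = 0 then 0
      else (prob_space.expectation M (\<lambda>\<omega>. rising_prod q k (X \<omega>) * (fwd_diff ^^ k) g (X \<omega>)))\<^sup>2
           / (fact k * prob_space.expectation M (\<lambda>\<omega>. rising_prod q k (X \<omega>))
              * (\<Prod>j=k-1..2*k-2. (1 - real j * \<delta>))))"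
  shows "ext_variance M (\<lambda>\<omega>. g (X \<omega>)) \<ge> ereal B
       \<and> (ext_variance M (\<lambda>\<omega>. g (X \<omega>)) = ereal B
            \<longleftrightarrow> (\<exists>P :: real poly. degree P \<le> n \<and> (\<forall>x\<in>J. g x = poly P (real x))))"
proof -
  interpret prob_space M by fact
  note X = assms(1-3)
  note int_iff = integrable_iff_summable[where p = p, OF X]
  note sums = expectation_sums[where p = p, OF X]
  interpret cumulative_ord_moment p q \<mu> \<delta> \<beta> \<gamma> n
  proof
    show "0 \<le> p x" for x by (simp add: assms(3))
    show "p sums 1" using sums[of "\<lambda>_. 1"] by (simp add: prob_space)
    show "(\<lambda>x. p x * real x) sums \<mu>" using sums[OF assms(4)] assms(5) by simp
    show "summable (\<lambda>x. p x * real x ^ (2 * n))" using assms(10) int_iff[of "\<lambda>x. real x ^ (2 * n)"] by simp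
  qed (use assms(6,7,9) in auto)
  \<comment> \<open>Nonnegativity of \<open>w\<close> turns the integrability hypotheses on
    differences into absolute summability.\<close>
  have wabs: "p x * \<bar>rising_prod q k x\<bar> = w k x" for k x
    using abs_of_nonneg[OF w_nonneg[of k x]] p_nonneg[of x] by (simp add: w_def abs_mult mult.commute)
  have sm: "summable (\<lambda>x. w k x * \<bar>(fwd_diff ^^ k) g x\<bar>)" if "k \<le> n" for k
  proof -
    have "p x * \<bar>rising_prod q k x * \<bar>(fwd_diff ^^ k) g x\<bar>\<bar> = w k x * \<bar>(fwd_diff ^^ k) g x\<bar>" for x
      by (simp add: abs_mult flip: wabs)
    then show ?thesis
      using assms(11)[OF that] int_iff[of "\<lambda>x. rising_prod q k x * \<bar>(fwd_diff ^^ k) g x\<bar>"] by simp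
  qed
  have EW: "expectation (\<lambda>\<omega>. rising_prod q k (X \<omega>)) = W k" if "k \<le> n" for k
  proof -
    have "integrable M (\<lambda>\<omega>. rising_prod q k (X \<omega>))"
      using wabs w_sums[OF that] int_iff[of "rising_prod q k"] by (simp add: sums_iff)
    from sums[OF this] show ?thesis by (simp add: W_def w_def sums_iff mult.commute)
  qed
  have Ee: "expectation (\<lambda>\<omega>. rising_prod q k (X \<omega>) * (fwd_diff ^^ k) g (X \<omega>)) =
      (\<Sum>x. w k x * (fwd_diff ^^ k) g x)" if "k \<le> n" for k
  proof -
    have "p x * \<bar>rising_prod q k x * (fwd_diff ^^ k) g x\<bar> = w k x * \<bar>(fwd_diff ^^ k) g x\<bar>" for x
      by (simp add: abs_mult flip: wabs)
    then have "integrable M (\<lambda>\<omega>. rising_prod q k (X \<omega>) * (fwd_diff ^^ k) g (X \<omega>))"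
      using sm[OF that] int_iff[of "\<lambda>x. rising_prod q k x * (fwd_diff ^^ k) g x"] by simp
    from sums[OF this] show ?thesis by (simp add: w_def sums_iff mult_ac)
  qed
  have B: "B = (\<Sum>k=1..n. if W k = 0 then 0 else (\<Sum>x. w k x * (fwd_diff ^^ k) g x)\<^sup>2 /
      (fact k * W k * (\<Prod>j=k-1..2*k-2. 1 - real j * \<delta>)))"
    unfolding B_def by (intro sum.cong) (auto simp: EW Ee)
  have sq_iff: "integrable M (\<lambda>\<omega>. (g (X \<omega>))\<^sup>2) \<longleftrightarrow> summable (\<lambda>x. p x * (g x)\<^sup>2)"
    using int_iff[of "\<lambda>x. (g x)\<^sup>2"] by simp
  have J: "(\<exists>P. degree P \<le> n \<and> (\<forall>x\<in>J. g x = poly P (real x))) \<longleftrightarrow>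
      (\<exists>P. degree P \<le> n \<and> (\<forall>x. p x > 0 \<longrightarrow> g x = poly P (real x)))"
    using assms(8) by simp
  show ?thesis
  proof (cases "summable (\<lambda>x. p x * (g x)\<^sup>2)")
    case True
    have int: "integrable M (\<lambda>\<omega>. (g (X \<omega>))\<^sup>2)" "integrable M (\<lambda>\<omega>. g (X \<omega>))"
      using True sm[of 0] sq_iff int_iff[of g] by (simp_all add: w_0)
    have "variance (\<lambda>\<omega>. g (X \<omega>)) = (\<Sum>x. p x * (g x)\<^sup>2) - (\<Sum>x. p x * g x)\<^sup>2"
      using sums[OF int(1)] sums[OF int(2)] by (simp add: variance_eq[OF int(2,1)] sums_iff)
    then show ?thesis
      using bessel[OF True sm] int(1) unfolding J B ext_variance_def by simp
  next
    case False
    \<comment> \<open>The variance is infinite and \<open>B\<close> is real, so both sides of the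
      equality criterion are false.\<close>
    then have "\<not> (\<exists>P. degree P \<le> n \<and> (\<forall>x. p x > 0 \<longrightarrow> g x = poly P (real x)))"
      using summable_poly_square by blast
    with False show ?thesis unfolding J ext_variance_def sq_iff by simp
  qed
qed

end
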